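(* Let $V$ be a real inner product space of dimension $d$ with orthonormal basis $e_1,\dots,e_d$, let $p\in[1,3)$, and let $\mathbb X,\mathbb Y$ be geometric $p$-rough paths in $V$ over $[0,T]$. Let $[s,s'],[t,t']\subseteq[0,T]$ and $\mathbb A,\mathbb B\in E$. Write $$\log_2 S(\mathbb X)_{s,s'}=\sum_{i=1}^d x^{(i)}e_i+\sum_{i,j=1}^d x^{(i,j)}e_i\otimes e_j,\qquad \log_2 S(\mathbb Y)_{t,t'}=\sum_{i=1}^d y^{(i)}e_i+\sum_{i,j=1}^d y^{(i,j)}e_i\otimes e_j .$$ Let $\mathbb Z^x,\mathbb Z^y:[0,1]\to E$ be the solutions of the step-$2$ log-ODEs $$\frac{d\mathbb Z^x_u}{du}=\mathbb Z^x_u\cdot\log_2S(\mathbb X)_{s,s'},\ \ \mathbb Z^x_0=\mathbb A,\qquad \frac{d\mathbb Z^y_v}{dv}=\mathbb Z^y_v\cdot\log_2S(\mathbb Y)_{t,t'},\ \ \mathbb Z^y_0=\mathbb B .$$ Then the real-valued functions on $[0,1]^2$ $$f_{u,v}=\langle\mathbb Z^x_u,\mathbb Z^y_v\rangle,\quad \varphi^{(i)}_{u,v}=\langle\mathbb Z^x_u\cdot e_i,\mathbb Z^y_v\rangle,\quad \psi^{(i)}_{u,v}=\langle\mathbb Z^x_u,\mathbb Z^y_v\cdot e_i\rangle,\qquad i=1,\dots,d,$$ satisfy, for all $(u,v)\in[0,1]\times[0,1]$ and $j=1,\dots,d$, the system $$\frac{\partial^2f}{\partial u\,\partial v}=\gamma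 f+\sum_{j=1}^d\alpha_j\varphi^{(j)}+\sum_{j=1}^d\beta_j\psi^{(j)},$$ $$\frac{\partial\varphi^{(j)}}{\partial v}=y^{(j)}f+\sum_{i=1}^dy^{(i,j)}\psi^{(i)},\qquad \frac{\partial\psi^{(j)}}{\partial u}=x^{(j)}f+\sum_{i=1}^dx^{(i,j)}\varphi^{(i)},$$ with boundary conditions $$f_{0,v}=\langle\mathbb A,\mathbb Z^y_v\rangle,\quad \varphi^{(i)}_{0,v}=\langle\mathbb A\cdot e_i,\mathbb Z^y_v\rangle,\quad \psi^{(i)}_{0,v}=\langle\mathbb A,\mathbb Z^y_v\cdot e_i\rangle,$$ $$f_{u,0}=\langle\mathbb Z^x_u,\mathbb B\rangle,\quad \varphi^{(i)}_{u,0}=\langle\mathbb Z^x_u\cdot e_i,\mathbb B\rangle,\quad \psi^{(i)}_{u,0}=\langle\mathbb Z^x_u,\mathbb B\cdot e_i\rangle,$$ where $$\alpha_j=\sum_{i=1}^dx^{(j,i)}y^{(i)},\quad \beta_j=\sum_{i=1}^dx^{(i)}y^{(j,i)},\quad \gamma=\sum_{i=1}^dx^{(i)}y^{(i)}+\sum_{i,j=1}^dx^{(i,j)}y^{(i,j)} .$$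
   Context: $T((V))=\prod_{k\ge0}V^{\otimes k}$ with elements $\mathbb A=(a^0,a^1,\dots)$ and product $(\mathbb A\cdot\mathbb B)^n=\sum_{k=0}^na^k\otimes b^{n-k}$; unit $\mathbb 1=(1,0,0,\dots)$. Each $V^{\otimes k}$ carries the Hilbert–Schmidt inner product $\langle\cdot,\cdot\rangle_k$ induced by that of $V$, and $\langle\mathbb A,\mathbb B\rangle=\sum_{k\ge0}\langle a^k,b^k\rangle_k$. $E=\{\mathbb A\in T((V)):\|\mathbb A\|_1:=\sum_k\|a^k\|_{V^{\otimes k}}<\infty\}$, a Banach algebra. Elements of $V^{\otimes k}$ are regarded as elements of $T((V))$ concentrated in degree $k$. A $p$-rough path over $[0,T]$ is a continuous map $\mathbb X:\{0\le s\le t\le T\}\to\bigoplus_{k=0}^{\lfloor p\rfloor}V^{\otimes k}$ with degree-$0$ component $1$, satisfying Chen's identity $\mathbb X_{s,u}\cdot\mathbb X_{u,t}=\mathbb X_{s,t}$ (in the truncated algebra) and of finite $p$-variation; it is geometric if it is a limit in $p$-variation of truncated signatures (iterated integrals up to degree $\lfloor p\rfloor$) of continuous bounded variation paths. $S(\mathbb X)_{s,t}\in T((V))$ denotes the signature of $\mathbb X$: the unique extension (Lyons' extension theorem) of $\mathbb X$ to a $T((V))$-valued multiplicative functional of finite $p$-variation. For $\mathbb A$ with $a^0=0$, $\log(\mathbb 1+\mathbb A)=\sum_{k\ge1}\frac{(-1)^{k-1}}k\mathbb A^{\cdot k}$; $\log_n S(\mathbb X)_{s,t}$ is the projection of $\log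 S(\mathbb X)_{s,t}$ onto degrees $\le n$ (its degree-$0$ component is $0$). *)

theory Defs
  imports "HOL-Analysis.Analysis"
begin

section \<open>The tensor series algebra\<close>

text \<open>
  For a finite-dimensional inner product space \<open>V\<close>, the space \<open>V\<^sup>\<otimes>\<^sup>k\<close> is identified with the
  \<open>k\<close>-linear forms on \<open>V\<close>: the tensor \<open>v\<^sub>1 \<otimes> \<dots> \<otimes> v\<^sub>k\<close> is the form sending
  \<open>(u\<^sub>1, \<dots>, u\<^sub>k)\<close> to \<open>(v\<^sub>1 \<bullet> u\<^sub>1) \<cdots> (v\<^sub>k \<bullet> u\<^sub>k)\<close>.  An element \<open>(a\<^sup>0, a\<^sup>1, \<dots>)\<close> of
  \<open>T((V))\<close> is therefore a real function on lists of vectors whose restriction to lists of length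
  \<open>k\<close> is the \<open>k\<close>-linear form \<open>a\<^sup>k\<close>.
\<close>

typedef (overloaded) 'v tensor_series =
  "{a :: ('v::euclidean_space) list \<Rightarrow> real. \<forall>xs ys. linear (\<lambda>v. a (xs @ v # ys))}"
  morphisms tcoeff Tensor_Series
  by (rule exI[of _ "\<lambda>_. 0"]) (auto simp: linear_iff)

setup_lifting type_definition_tensor_series

lemma tcoeff_linear: "linear (\<lambda>v. tcoeff a (xs @ v # ys))"
  using tcoeff[of a] by simp

lemma tensor_series_eqI: "(\<And>w. tcoeff a w = tcoeff b w) \<Longrightarrow> a = b"
  by (auto simp: tcoeff_inject[symmetric])

instantiation tensor_series :: (euclidean_space) real_vector
begin

lift_definition zero_tensor_series :: "'a tensor_series" is "\<lambda>_. 0"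
  by (auto simp: linear_iff)

lift_definition plus_tensor_series :: "'a tensor_series \<Rightarrow> 'a tensor_series \<Rightarrow> 'a tensor_series"
  is "\<lambda>a b w. a w + b w"
  by (auto simp: linear_iff algebra_simps)

lift_definition minus_tensor_series :: "'a tensor_series \<Rightarrow> 'a tensor_series \<Rightarrow> 'a tensor_series"
  is "\<lambda>a b w. a w - b w"
  by (auto simp: linear_iff algebra_simps)

lift_definition uminus_tensor_series :: "'a tensor_series \<Rightarrow> 'a tensor_series"
  is "\<lambda>a w. - a w"
  by (auto simp: linear_iff algebra_simps)

lift_definition scaleR_tensor_series :: "real \<Rightarrow> 'a tensor_series \<Rightarrow> 'a tensor_series"
  is "\<lambda>c a w. c * a w"
  by (auto simp: linear_iff algebra_simps)

instance
  by standard (transfer; simp add: algebra_simps fun_eq_iff)+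

end

text \<open>
  The product: on lists of length \<open>n\<close> the sum below is \<open>\<Sum>k\<le>n. a\<^sup>k \<otimes> b\<^sup>n\<^sup>-\<^sup>k\<close>.
\<close>

instantiation tensor_series :: (euclidean_space) ring_1
begin

lift_definition one_tensor_series :: "'a tensor_series" is "\<lambda>w. if w = [] then 1 else 0"
  by (auto simp: linear_iff)

lift_definition times_tensor_series :: "'a tensor_series \<Rightarrow> 'a tensor_series \<Rightarrow> 'a tensor_series"
  is "\<lambda>a b w. \<Sum>k\<le>length w. a (take k w) * b (drop k w)"
proof -
  fix a b :: "'a list \<Rightarrow> real" and xs ys :: "'a list"
  assume a: "\<And>xs ys. linear (\<lambda>v. a (xs @ v # ys))" and b: "\<And>xs ys. linear (\<lambda>v. b (xs @ v # ys))"
  have "linear (\<lambda>v. a (take k (xs @ v # ys)) * b (drop k (xs @ v # ys)))" for k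
  proof (cases "k \<le> length xs")
    case True
    then show ?thesis
      using b[of "drop k xs" ys] by (simp add: linear_iff algebra_simps)
  next
    case False
    then obtain m where "k = length xs + Suc m"
      by (metis add_Suc_right less_imp_Suc_add not_le_imp_less)
    then show ?thesis
      using a[of xs "take m ys"] by (simp add: linear_iff algebra_simps)
  qed
  then have "linear (\<lambda>v. \<Sum>k\<le>length xs + Suc (length ys).
      a (take k (xs @ v # ys)) * b (drop k (xs @ v # ys)))"
    by (intro linear_compose_sum) auto
  then show "linear (\<lambda>v. \<Sum>k\<le>length (xs @ v # ys).
      a (take k (xs @ v # ys)) * b (drop k (xs @ v # ys)))"
    by simp
qed

instance
proof
  fix a b c :: "'a tensor_series"
  show "a * b * c = a * (b * c)"
  proof (rule tensor_series_eqI)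
    fix w :: "'a list"
    define n where "n = length w"
    have "tcoeff (a * b * c) w = (\<Sum>k=0..n. \<Sum>j=0..k.
        tcoeff a (take j w) * tcoeff b (take (k - j) (drop j w)) * tcoeff c (drop (n - (n - k)) w))"
      by (auto simp: times_tensor_series.rep_eq n_def sum_distrib_right atMost_atLeast0 min_absorb2
          drop_take intro!: sum.cong)
    also have "\<dots> = (\<Sum>k=0..n. \<Sum>j=0..n - k.
        tcoeff a (take k w) * tcoeff b (take j (drop k w)) * tcoeff c (drop (n - (n - k - j)) w))"
      by (rule fps_mult_assoc_lemma[where k = n and n = n and f =
          "\<lambda>i j l. tcoeff a (take i w) * tcoeff b (take j (drop i w)) * tcoeff c (drop (n - l) w)"])
    also have "\<dots> = tcoeff (a * (b * c)) w"
      by (auto simp: times_tensor_series.rep_eq n_def sum_distrib_left atMost_atLeast0 mult.assoc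
          add.commute intro!: sum.cong)
    finally show "tcoeff (a * b * c) w = tcoeff (a * (b * c)) w" .
  qed
  show "1 * a = a"
  proof (rule tensor_series_eqI)
    fix w :: "'a list"
    have "tcoeff (1 * a) w = (\<Sum>k\<le>length w. if k = 0 then tcoeff a w else 0)"
      unfolding times_tensor_series.rep_eq one_tensor_series.rep_eq by (rule sum.cong) auto
    then show "tcoeff (1 * a) w = tcoeff a w" by simp
  qed
  show "a * 1 = a"
  proof (rule tensor_series_eqI)
    fix w :: "'a list"
    have "tcoeff (a * 1) w = (\<Sum>k\<le>length w. if k = length w then tcoeff a w else 0)"
      unfolding times_tensor_series.rep_eq one_tensor_series.rep_eq by (rule sum.cong) auto
    then show "tcoeff (a * 1) w = tcoeff a w" by simp
  qed
  show "(a + b) * c = a * c + b * c"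
    by (rule tensor_series_eqI)
      (simp add: times_tensor_series.rep_eq plus_tensor_series.rep_eq algebra_simps sum.distrib)
  show "a * (b + c) = a * b + a * c"
    by (rule tensor_series_eqI)
      (simp add: times_tensor_series.rep_eq plus_tensor_series.rep_eq algebra_simps sum.distrib)
  show "(0::'a tensor_series) \<noteq> 1"
    by transfer (auto simp: fun_eq_iff)
qed

end

lift_definition tvec :: "'v::euclidean_space \<Rightarrow> 'v tensor_series"
  is "\<lambda>v w. case w of [u] \<Rightarrow> v \<bullet> u | _ \<Rightarrow> 0"
proof -
  fix v :: 'v and xs ys :: "'v list"
  show "linear (\<lambda>u. case xs @ u # ys of [u] \<Rightarrow> v \<bullet> u | _ \<Rightarrow> 0)"
    by (cases xs; cases ys; cases "tl xs")
      (auto simp: linear_iff inner_right_distrib split: list.splits)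
qed

lift_definition ttrunc :: "nat \<Rightarrow> ('v::euclidean_space) tensor_series \<Rightarrow> 'v tensor_series"
  is "\<lambda>n a w. if length w \<le> n then a w else 0"
proof -
  fix n and a :: "'v list \<Rightarrow> real" and xs ys :: "'v list"
  assume "\<And>xs ys. linear (\<lambda>v. a (xs @ v # ys))"
  then show "linear (\<lambda>v. if length (xs @ v # ys) \<le> n then a (xs @ v # ys) else 0)"
    by (simp add: linear_iff)
qed

text \<open>
  Hilbert--Schmidt inner product on \<open>V\<^sup>\<otimes>\<^sup>k\<close> and its norm: the tensors \<open>b\<^sub>1 \<otimes> \<dots> \<otimes> b\<^sub>k\<close> with
  \<open>b\<^sub>i \<in> Basis\<close> are orthonormal, and the coordinates of \<open>a\<^sup>k\<close> along them are its values as a form.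
\<close>

definition words :: "nat \<Rightarrow> ('v::euclidean_space) list set" where
  "words k = {w. set w \<subseteq> Basis \<and> length w = k}"

definition hs_inner :: "nat \<Rightarrow> ('v::euclidean_space) tensor_series \<Rightarrow> 'v tensor_series \<Rightarrow> real" where
  "hs_inner k a b = (\<Sum>w\<in>words k. tcoeff a w * tcoeff b w)"

definition hs_norm :: "nat \<Rightarrow> ('v::euclidean_space) tensor_series \<Rightarrow> real" where
  "hs_norm k a = sqrt (hs_inner k a a)"

lemma finite_words [simp]: "finite (words k)"
  unfolding words_def by (rule finite_lists_length_eq) simp

lemma hs_norm_L2: "hs_norm k a = L2_set (tcoeff a) (words k)"
  by (simp add: hs_norm_def hs_inner_def L2_set_def power2_eq_square)

lemma hs_norm_nonneg [simp]: "0 \<le> hs_norm k a"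
  by (simp add: hs_norm_L2)

lemma hs_norm_0 [simp]: "hs_norm k 0 = 0"
  by (simp add: hs_norm_L2 L2_set_def zero_tensor_series.rep_eq)

lemma hs_norm_triangle: "hs_norm k (a + b) \<le> hs_norm k a + hs_norm k b"
  unfolding hs_norm_L2 plus_tensor_series.rep_eq by (rule L2_set_triangle_ineq)

lemma hs_norm_scaleR: "hs_norm k (c *\<^sub>R a) = \<bar>c\<bar> * hs_norm k a"
proof -
  have "hs_inner k (c *\<^sub>R a) (c *\<^sub>R a) = c\<^sup>2 * hs_inner k a a"
    by (simp add: hs_inner_def scaleR_tensor_series.rep_eq sum_distrib_left power2_eq_square
        mult.assoc mult.left_commute)
  then show ?thesis
    by (simp add: hs_norm_def real_sqrt_mult)
qed

lemma hs_norm_uminus: "hs_norm k (- a) = hs_norm k a"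
  using hs_norm_scaleR[of k "-1" a] by simp

lemma hs_norm_eq_0_iff: "hs_norm k a = 0 \<longleftrightarrow> (\<forall>w\<in>words k. tcoeff a w = 0)"
  by (simp add: hs_norm_L2 L2_set_eq_0_iff)

lemma tensor_series_eq_0I:
  assumes "\<And>k. hs_norm k a = 0"
  shows "a = 0"
proof -
  have *: "set ys \<subseteq> Basis \<Longrightarrow> tcoeff a (ys @ xs) = 0" for xs ys
  proof (induction xs arbitrary: ys)
    case Nil
    then show ?case
      using assms[of "length ys"] by (simp add: hs_norm_eq_0_iff words_def)
  next
    case (Cons x xs)
    have "tcoeff a (ys @ x # xs) = tcoeff a (ys @ (\<Sum>b\<in>Basis. (x \<bullet> b) *\<^sub>R b) # xs)"
      by (simp add: euclidean_representation)
    also have "\<dots> = (\<Sum>b\<in>Basis. (x \<bullet> b) * tcoeff a (ys @ b # xs))"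
      by (subst linear_sum[OF tcoeff_linear])
        (simp add: linear_cmul[OF tcoeff_linear])
    also have "\<dots> = 0"
    proof (rule sum.neutral, rule ballI)
      fix b :: 'a assume "b \<in> Basis"
      then show "(x \<bullet> b) * tcoeff a (ys @ b # xs) = 0"
        using Cons.IH[of "ys @ [b]"] Cons.prems by simp
    qed
    finally show ?case .
  qed
  show ?thesis
    by (rule tensor_series_eqI) (use *[of "[]"] in \<open>simp add: zero_tensor_series.rep_eq\<close>)
qed

lemma hs_norm_times: "hs_norm n (a * b) \<le> (\<Sum>k\<le>n. hs_norm k a * hs_norm (n - k) b)"
proof -
  have tri: "L2_set (\<lambda>w. \<Sum>k\<in>K. f k w) A \<le> (\<Sum>k\<in>K. L2_set (f k) A)"
    if "finite K" for K :: "nat set" and f and A :: "'a list set"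
    using that
  proof (induction K rule: finite_induct)
    case empty
    then show ?case by (simp add: L2_set_def)
  next
    case (insert k K)
    have "L2_set (\<lambda>w. \<Sum>k\<in>insert k K. f k w) A = L2_set (\<lambda>w. f k w + (\<Sum>k\<in>K. f k w)) A"
      using insert by simp
    also have "\<dots> \<le> L2_set (f k) A + L2_set (\<lambda>w. \<Sum>k\<in>K. f k w) A"
      by (rule L2_set_triangle_ineq)
    finally show ?case using insert by simp
  qed
  have split: "L2_set (\<lambda>w. tcoeff a (take k w) * tcoeff b (drop k w)) (words n)
      = hs_norm k a * hs_norm (n - k) b" if "k \<le> n" for k
  proof -
    have "(\<Sum>w\<in>words n. (tcoeff a (take k w) * tcoeff b (drop k w))\<^sup>2)
        = (\<Sum>(x, y)\<in>words k \<times> words (n - k). (tcoeff a x)\<^sup>2 * (tcoeff b y)\<^sup>2)"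
      using that
      by (intro sum.reindex_bij_witness[of _ "\<lambda>(x, y). x @ y" "\<lambda>w. (take k w, drop k w)"])
        (auto simp: words_def power_mult_distrib dest: in_set_takeD in_set_dropD)
    also have "\<dots> = (\<Sum>x\<in>words k. (tcoeff a x)\<^sup>2) * (\<Sum>y\<in>words (n - k). (tcoeff b y)\<^sup>2)"
      by (simp add: sum_product sum.cartesian_product)
    finally show ?thesis
      by (simp add: hs_norm_L2 L2_set_def real_sqrt_mult)
  qed
  have "hs_norm n (a * b)
      = L2_set (\<lambda>w. \<Sum>k\<le>n. tcoeff a (take k w) * tcoeff b (drop k w)) (words n)"
    unfolding hs_norm_L2 times_tensor_series.rep_eq
    by (rule L2_set_cong) (auto simp: words_def)
  also have "\<dots> \<le> (\<Sum>k\<le>n. L2_set (\<lambda>w. tcoeff a (take k w) * tcoeff b (drop k w)) (words n))"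
    by (rule tri) simp
  also have "\<dots> = (\<Sum>k\<le>n. hs_norm k a * hs_norm (n - k) b)"
    by (rule sum.cong) (auto simp: split)
  finally show ?thesis .
qed

text \<open>
  \<open>log (\<one> + A) = \<Sum>k\<ge>1. (-1)\<^sup>k\<^sup>-\<^sup>1/k A\<^sup>k\<close> with \<open>A = S - \<one>\<close>.  If \<open>a\<^sup>0 = 0\<close> then \<open>A\<^sup>k\<close> vanishes in degrees
  below \<open>k\<close>, so in degree \<open>n\<close> only the terms \<open>k \<le> n\<close> contribute; see \<open>tlog_sums\<close>.
\<close>

lift_definition tlog :: "('v::euclidean_space) tensor_series \<Rightarrow> 'v tensor_series"
  is "\<lambda>S w. \<Sum>k=1..length w. (-1) ^ (k - 1) / real k * tcoeff ((S - 1) ^ k) w"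
proof -
  fix S :: "'v tensor_series" and xs ys :: "'v list"
  have "linear (\<lambda>v. \<Sum>k=1..length xs + Suc (length ys).
      (-1) ^ (k - 1) / real k * tcoeff ((S - 1) ^ k) (xs @ v # ys))"
    by (intro linear_compose_sum ballI linear_compose_scale_right[where 'b = real, simplified] tcoeff_linear)
  then show "linear (\<lambda>v. \<Sum>k=1..length (xs @ v # ys).
      (-1) ^ (k - 1) / real k * tcoeff ((S - 1) ^ k) (xs @ v # ys))"
    by simp
qed

lemma tcoeff_power_eq_0:
  assumes "tcoeff a [] = 0"
  shows "length w < k \<Longrightarrow> tcoeff (a ^ k) w = 0"
proof (induction k arbitrary: w)
  case (Suc k)
  have "tcoeff a (take j w) * tcoeff (a ^ k) (drop j w) = 0" if "j \<le> length w" for j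
    using that Suc assms by (cases "j = 0") auto
  then show ?case
    by (auto simp: times_tensor_series.rep_eq intro!: sum.neutral)
qed simp

lemma tlog_sums:
  assumes "tcoeff S [] = 1"
  shows "(\<lambda>k. (-1) ^ k / real (Suc k) * tcoeff ((S - 1) ^ Suc k) w) sums tcoeff (tlog S) w"
proof -
  have "tcoeff (S - 1) [] = 0"
    using assms by (simp add: minus_tensor_series.rep_eq one_tensor_series.rep_eq)
  note z = tcoeff_power_eq_0[OF this]
  have "(\<lambda>k. (-1) ^ k / real (Suc k) * tcoeff ((S - 1) ^ Suc k) w) sums
      (\<Sum>k<length w. (-1) ^ k / real (Suc k) * tcoeff ((S - 1) ^ Suc k) w)"
    by (rule sums_finite) (auto simp: z simp del: power_Suc)
  also have "(\<Sum>k<length w. (-1) ^ k / real (Suc k) * tcoeff ((S - 1) ^ Suc k) w) = tcoeff (tlog S) w"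
    unfolding tlog.rep_eq
    by (rule sum.reindex_bij_witness[of _ "\<lambda>k. k - 1" Suc]) auto
  finally show ?thesis .
qed


section \<open>The algebra E of absolutely summable series\<close>

typedef (overloaded) 'v tensor_l1 =
  "{a :: ('v::euclidean_space) tensor_series. summable (\<lambda>k. hs_norm k a)}"
  morphisms series_of Tensor_L1
  by (rule exI[of _ 0]) simp

setup_lifting type_definition_tensor_l1

lemma summable_series_of: "summable (\<lambda>k. hs_norm k (series_of a))"
  using series_of[of a] by simp

lemma summable_plus:
  assumes "summable (\<lambda>k. hs_norm k a)" "summable (\<lambda>k. hs_norm k b)"
  shows "summable (\<lambda>k. hs_norm k (a + b))"
  by (rule summable_comparison_test'[OF summable_add[OF assms], of 0])
    (auto simp: hs_norm_triangle)

lemma summable_times: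
  assumes "summable (\<lambda>k. hs_norm k a)" "summable (\<lambda>k. hs_norm k b)"
  shows "summable (\<lambda>k. hs_norm k (a * b))"
    and "(\<Sum>k. hs_norm k (a * b)) \<le> (\<Sum>k. hs_norm k a) * (\<Sum>k. hs_norm k b)"
proof -
  have c: "summable (\<lambda>n. \<Sum>k\<le>n. hs_norm k a * hs_norm (n - k) b)"
      "(\<Sum>k. hs_norm k a) * (\<Sum>k. hs_norm k b) = (\<Sum>n. \<Sum>k\<le>n. hs_norm k a * hs_norm (n - k) b)"
    using assms by (auto intro!: summable_Cauchy_product Cauchy_product)
  show s: "summable (\<lambda>k. hs_norm k (a * b))"
    by (rule summable_comparison_test'[OF c(1), of 0]) (use hs_norm_times in auto)
  show "(\<Sum>k. hs_norm k (a * b)) \<le> (\<Sum>k. hs_norm k a) * (\<Sum>k. hs_norm k b)"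
    unfolding c(2) by (intro suminf_le s c hs_norm_times)
qed

lemma hs_norm_ttrunc: "hs_norm k (ttrunc n a) = (if k \<le> n then hs_norm k a else 0)"
  by (auto simp: hs_norm_def hs_inner_def ttrunc.rep_eq words_def intro!: sum.cong)

lemma hs_norm_one: "hs_norm k (1 :: ('v::euclidean_space) tensor_series) = (if k = 0 then 1 else 0)"
proof (cases "k = 0")
  case True
  have "words 0 = {[] :: 'v list}" by (auto simp: words_def)
  then show ?thesis
    using True by (simp add: hs_norm_def hs_inner_def one_tensor_series.rep_eq)
next
  case False
  then show ?thesis
    by (auto simp: hs_norm_eq_0_iff one_tensor_series.rep_eq words_def)
qed

instantiation tensor_l1 :: (euclidean_space) real_vector
begin

lift_definition zero_tensor_l1 :: "'a tensor_l1" is 0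
  by simp

lift_definition plus_tensor_l1 :: "'a tensor_l1 \<Rightarrow> 'a tensor_l1 \<Rightarrow> 'a tensor_l1" is "(+)"
  by (rule summable_plus)

lift_definition uminus_tensor_l1 :: "'a tensor_l1 \<Rightarrow> 'a tensor_l1" is uminus
  by (simp add: hs_norm_uminus)

definition minus_tensor_l1 :: "'a tensor_l1 \<Rightarrow> 'a tensor_l1 \<Rightarrow> 'a tensor_l1" where
  "minus_tensor_l1 a b = a + - b"

lift_definition scaleR_tensor_l1 :: "real \<Rightarrow> 'a tensor_l1 \<Rightarrow> 'a tensor_l1" is "scaleR"
  unfolding hs_norm_scaleR by (rule summable_mult)

instance
proof
  fix a b c :: "'a tensor_l1" and r q :: real
  show "a + b + c = a + (b + c)" by transfer (simp add: add.assoc)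
  show "a + b = b + a" by transfer (simp add: add.commute)
  show "0 + a = a" by transfer simp
  show "- a + a = 0" by transfer simp
  show "a - b = a + - b" by (simp add: minus_tensor_l1_def)
  show "r *\<^sub>R (a + b) = r *\<^sub>R a + r *\<^sub>R b" by transfer (simp add: scaleR_add_right)
  show "(r + q) *\<^sub>R a = r *\<^sub>R a + q *\<^sub>R a" by transfer (simp add: scaleR_add_left)
  show "r *\<^sub>R q *\<^sub>R a = (r * q) *\<^sub>R a" by transfer simp
  show "1 *\<^sub>R a = a" by transfer simp
qed

end

instantiation tensor_l1 :: (euclidean_space) real_normed_algebra_1
begin

lift_definition one_tensor_l1 :: "'a tensor_l1" is 1
  unfolding hs_norm_one by (rule summable_finite[of "{0}"]) auto

lift_definition times_tensor_l1 :: "'a tensor_l1 \<Rightarrow> 'a tensor_l1 \<Rightarrow> 'a tensor_l1" is "(*)"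
  by (rule summable_times)

lift_definition norm_tensor_l1 :: "'a tensor_l1 \<Rightarrow> real" is "\<lambda>a. \<Sum>k. hs_norm k a" .

definition sgn_tensor_l1 :: "'a tensor_l1 \<Rightarrow> 'a tensor_l1" where
  "sgn_tensor_l1 a = a /\<^sub>R norm a"

definition dist_tensor_l1 :: "'a tensor_l1 \<Rightarrow> 'a tensor_l1 \<Rightarrow> real" where
  "dist_tensor_l1 a b = norm (a - b)"

definition uniformity_tensor_l1 :: "('a tensor_l1 \<times> 'a tensor_l1) filter" where
  "uniformity_tensor_l1 = (INF e\<in>{0<..}. principal {(x, y). dist x y < e})"

definition open_tensor_l1 :: "'a tensor_l1 set \<Rightarrow> bool" where
  "open_tensor_l1 U \<longleftrightarrow> (\<forall>x\<in>U. eventually (\<lambda>(x', y). x' = x \<longrightarrow> y \<in> U) uniformity)"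

instance
proof
  fix a b c :: "'a tensor_l1" and r :: real
  show "a * b * c = a * (b * c)" by transfer (simp add: mult.assoc)
  show "1 * a = a" by transfer simp
  show "a * 1 = a" by transfer simp
  show "(a + b) * c = a * c + b * c" by transfer (simp add: distrib_right)
  show "a * (b + c) = a * b + a * c" by transfer (simp add: distrib_left)
  show "(0::'a tensor_l1) \<noteq> 1" by transfer simp
  show "r *\<^sub>R a * b = r *\<^sub>R (a * b)"
    by (transfer, rule tensor_series_eqI)
      (simp add: times_tensor_series.rep_eq scaleR_tensor_series.rep_eq sum_distrib_left mult.assoc)
  show "a * r *\<^sub>R b = r *\<^sub>R (a * b)"
    by (transfer, rule tensor_series_eqI)
      (simp add: times_tensor_series.rep_eq scaleR_tensor_series.rep_eq sum_distrib_left
        mult.left_commute)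
  show "sgn a = a /\<^sub>R norm a" by (rule sgn_tensor_l1_def)
  show "dist a b = norm (a - b)" by (rule dist_tensor_l1_def)
  show "(uniformity :: ('a tensor_l1 \<times> 'a tensor_l1) filter)
      = (INF e\<in>{0<..}. principal {(x, y). dist x y < e})"
    by (rule uniformity_tensor_l1_def)
  show "open U \<longleftrightarrow> (\<forall>x\<in>U. eventually (\<lambda>(x', y). x' = x \<longrightarrow> y \<in> U) uniformity)"
    for U :: "'a tensor_l1 set"
    by (rule open_tensor_l1_def)
  show "norm a = 0 \<longleftrightarrow> a = 0"
    by transfer (auto simp: suminf_eq_zero_iff intro: tensor_series_eq_0I)
  show "norm (a + b) \<le> norm a + norm b"
  proof transfer
    fix a b :: "'a tensor_series"
    assume s: "summable (\<lambda>k. hs_norm k a)" "summable (\<lambda>k. hs_norm k b)"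
    then show "(\<Sum>k. hs_norm k (a + b)) \<le> (\<Sum>k. hs_norm k a) + (\<Sum>k. hs_norm k b)"
      unfolding suminf_add[OF s]
      by (intro suminf_le summable_add summable_plus hs_norm_triangle)
  qed
  show "norm (r *\<^sub>R a) = \<bar>r\<bar> * norm a"
    by transfer (simp add: hs_norm_scaleR suminf_mult)
  show "norm (a * b) \<le> norm a * norm b"
    by transfer (rule summable_times)
  show "norm (1 :: 'a tensor_l1) = 1"
    by transfer (use sums_unique[OF sums_single[of 0 "\<lambda>_. 1 :: real"]] in \<open>simp add: hs_norm_one\<close>)
qed

end

lift_definition vec_E :: "'v::euclidean_space \<Rightarrow> 'v tensor_l1" is tvec
  by (rule summable_finite[of "{1}"])
    (auto simp: hs_norm_eq_0_iff words_def tvec.rep_eq split: list.splits)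

lift_definition trunc_E :: "nat \<Rightarrow> ('v::euclidean_space) tensor_series \<Rightarrow> 'v tensor_l1" is ttrunc
  by (rule summable_finite[of "{..n}" for n]) (auto simp: hs_norm_ttrunc)

definition inner_E :: "('v::euclidean_space) tensor_l1 \<Rightarrow> 'v tensor_l1 \<Rightarrow> real" where
  "inner_E a b = (\<Sum>k. hs_inner k (series_of a) (series_of b))"


section \<open>Rough paths and their signatures\<close>

definition is_partition :: "real \<Rightarrow> real \<Rightarrow> nat \<Rightarrow> (nat \<Rightarrow> real) \<Rightarrow> bool" where
  "is_partition a b n \<tau> \<longleftrightarrow> \<tau> 0 = a \<and> \<tau> n = b \<and> (\<forall>i<n. \<tau> i \<le> \<tau> (Suc i))"

definition triangle :: "real \<Rightarrow> (real \<times> real) set" where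
  "triangle T = {(s, t). 0 \<le> s \<and> s \<le> t \<and> t \<le> T}"

definition variation :: "real \<Rightarrow> real \<Rightarrow> (real \<Rightarrow> real \<Rightarrow> real) \<Rightarrow> ennreal" where
  "variation q T F = (SUP (n, \<tau>)\<in>{(n, \<tau>). is_partition 0 T n \<tau>}.
     ennreal (\<Sum>i<n. \<bar>F (\<tau> i) (\<tau> (Suc i))\<bar> powr q))"

definition finite_p_variation ::
    "real \<Rightarrow> real \<Rightarrow> nat set \<Rightarrow> (real \<Rightarrow> real \<Rightarrow> ('v::euclidean_space) tensor_series) \<Rightarrow> bool" where
  "finite_p_variation p T K X \<longleftrightarrow>
     (\<forall>k\<in>K. variation (p / real k) T (\<lambda>s t. hs_norm k (X s t)) < \<infinity>)"

text \<open>Values in the truncated algebra are tensor series vanishing in all degrees above \<open>\<lfloor>p\<rfloor>\<close>.\<close>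

definition rough_path ::
    "real \<Rightarrow> real \<Rightarrow> (real \<Rightarrow> real \<Rightarrow> ('v::euclidean_space) tensor_series) \<Rightarrow> bool" where
  "rough_path p T X \<longleftrightarrow> (let N = nat \<lfloor>p\<rfloor> in
     (\<forall>(s, t)\<in>triangle T. ttrunc N (X s t) = X s t \<and> tcoeff (X s t) [] = 1) \<and>
     continuous_on (triangle T) (\<lambda>(s, t). trunc_E N (X s t)) \<and>
     (\<forall>s u t. 0 \<le> s \<and> s \<le> u \<and> u \<le> t \<and> t \<le> T \<longrightarrow> ttrunc N (X s u * X u t) = X s t) \<and>
     finite_p_variation p T {1..N} X)"

definition has_RS_integral ::
    "(real \<Rightarrow> real) \<Rightarrow> (real \<Rightarrow> real) \<Rightarrow> real \<Rightarrow> real \<Rightarrow> real \<Rightarrow> bool" where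
  \<comment> \<open>Riemann--Stieltjes integral of \<open>f\<close> against \<open>g\<close> over \<open>[a, b]\<close>\<close>
  "has_RS_integral f g a b I \<longleftrightarrow>
     (\<forall>\<epsilon>>0. \<exists>\<delta>>0. \<forall>n \<tau> \<xi>.
        is_partition a b n \<tau> \<and> (\<forall>i<n. \<xi> i \<in> {\<tau> i..\<tau> (Suc i)} \<and> \<tau> (Suc i) - \<tau> i < \<delta>) \<longrightarrow>
        \<bar>(\<Sum>i<n. f (\<xi> i) * (g (\<tau> (Suc i)) - g (\<tau> i))) - I\<bar> < \<epsilon>)"

text \<open>
  The iterated integrals \<open>\<integral> dx\<^sub>r\<^sub>1 \<otimes> \<dots> \<otimes> dx\<^sub>r\<^sub>k\<close> over \<open>s < r\<^sub>1 < \<dots> < r\<^sub>k < t\<close>, by recursion on the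
  outermost variable \<open>r\<^sub>k\<close>: degree by degree, \<open>S\<^sub>s\<^sub>,\<^sub>t = \<one> + \<integral> S\<^sub>s\<^sub>,\<^sub>r \<otimes> dx\<^sub>r\<close> (integral over \<open>[s, t]\<close>).
\<close>

definition is_path_signature ::
    "real \<Rightarrow> (real \<Rightarrow> 'v::euclidean_space) \<Rightarrow> (real \<Rightarrow> real \<Rightarrow> 'v tensor_series) \<Rightarrow> bool" where
  "is_path_signature T x S \<longleftrightarrow>
     (\<forall>(s, t)\<in>triangle T. tcoeff (S s t) [] = 1 \<and>
        (\<forall>w v. has_RS_integral (\<lambda>r. tcoeff (S s r) w) (\<lambda>r. x r \<bullet> v) s t (tcoeff (S s t) (w @ [v]))))"

definition bounded_variation_path :: "real \<Rightarrow> (real \<Rightarrow> 'v::euclidean_space) \<Rightarrow> bool" where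
  "bounded_variation_path T x \<longleftrightarrow> variation 1 T (\<lambda>s t. norm (x t - x s)) < \<infinity>"

text \<open>
  Convergence in \<open>p\<close>-variation is stated degree by degree; the usual distance is the maximum over
  \<open>1 \<le> k \<le> \<lfloor>p\<rfloor>\<close> of the \<open>k/p\<close>-th powers of the quantities below.
\<close>

definition geometric_rough_path ::
    "real \<Rightarrow> real \<Rightarrow> (real \<Rightarrow> real \<Rightarrow> ('v::euclidean_space) tensor_series) \<Rightarrow> bool" where
  "geometric_rough_path p T X \<longleftrightarrow> rough_path p T X \<and> (let N = nat \<lfloor>p\<rfloor> in
     \<exists>x S. (\<forall>m. continuous_on {0..T} (x m) \<and> bounded_variation_path T (x m) \<and>
                is_path_signature T (x m) (S m)) \<and>
           (\<forall>k\<in>{1..N}. (\<lambda>m. variation (p / real k) T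
                (\<lambda>s t. hs_norm k (ttrunc N (S m s t) - X s t))) \<longlonglongrightarrow> 0))"

definition is_lyons_extension :: "real \<Rightarrow> real \<Rightarrow>
    (real \<Rightarrow> real \<Rightarrow> ('v::euclidean_space) tensor_series) \<Rightarrow> (real \<Rightarrow> real \<Rightarrow> 'v tensor_series) \<Rightarrow> bool" where
  "is_lyons_extension p T X S \<longleftrightarrow>
     (\<forall>(s, t)\<in>triangle T. ttrunc (nat \<lfloor>p\<rfloor>) (S s t) = X s t \<and> tcoeff (S s t) [] = 1) \<and>
     (\<forall>n. continuous_on (triangle T) (\<lambda>(s, t). trunc_E n (S s t))) \<and>
     (\<forall>s u t. 0 \<le> s \<and> s \<le> u \<and> u \<le> t \<and> t \<le> T \<longrightarrow> S s u * S u t = S s t) \<and>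
     finite_p_variation p T {1..} S"

text \<open>
  By Lyons' extension theorem, for a \<open>p\<close>-rough path \<open>X\<close> over \<open>[0, T]\<close> and \<open>(s, t)\<close> in the triangle
  the description below has exactly one solution.
\<close>

definition rp_signature :: "real \<Rightarrow> real \<Rightarrow>
    (real \<Rightarrow> real \<Rightarrow> ('v::euclidean_space) tensor_series) \<Rightarrow> real \<Rightarrow> real \<Rightarrow> 'v tensor_series" where
  "rp_signature p T X s t = (THE a. \<exists>S. is_lyons_extension p T X S \<and> S s t = a)"

definition log_signature :: "nat \<Rightarrow> real \<Rightarrow> real \<Rightarrow>
    (real \<Rightarrow> real \<Rightarrow> ('v::euclidean_space) tensor_series) \<Rightarrow> real \<Rightarrow> real \<Rightarrow> 'v tensor_l1" where
  "log_signature n p T X s t = trunc_E n (tlog (rp_signature p T X s t))"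

end

(* The Hilbert-Schmidt pairing is bounded and bilinear on E, so it may be differentiated
   slot by slot along the two linear ODEs. A right factor in V splits off the pairing,
   <a \<otimes> v, b \<otimes> w> = (v \<bullet> w) <a, b>, and cancelling matching right factors e_j in the
   derivatives leaves only f, \<phi> and \<psi>, because the log-signatures have degree at most 2. *)
theory Submission
  imports Defs
begin

section \<open>Boundedness and bilinearity of the Hilbert-Schmidt pairing on
  \<open>E\<close>\<close>

lemma abs_hs_inner_le: "\<bar>hs_inner k a b\<bar> \<le> hs_norm k a * hs_norm k b"
proof -
  have "\<bar>hs_inner k a b\<bar> \<le> (\<Sum>w\<in>words k. \<bar>tcoeff a w\<bar> * \<bar>tcoeff b w\<bar>)"
    unfolding hs_inner_def by (rule order_trans[OF sum_abs]) (simp add: abs_mult)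
  also have "\<dots> \<le> hs_norm k a * hs_norm k b"
    unfolding hs_norm_L2 by (rule L2_set_mult_ineq)
  finally show ?thesis .
qed

lemma hs_norm_le_norm: "hs_norm k (series_of a) \<le> norm a"
  using sum_le_suminf[OF summable_series_of, of "{k}" a] by (simp add: norm_tensor_l1.rep_eq)

text \<open>The bound is asymmetric on purpose: as a sequence in \<open>k\<close>, its right side is
  a constant multiple of the summable sequence \<open>hs_norm k (series_of b)\<close>. It is the
  majorant both for the convergence of the pairing and for its estimate by the product of the
  norms.\<close>

lemma abs_hs_inner_le_norm:
  "\<bar>hs_inner k (series_of a) (series_of b)\<bar> \<le> norm a * hs_norm k (series_of b)"
  by (rule order_trans[OF abs_hs_inner_le]) (simp add: hs_norm_le_norm mult_right_mono)

lemma summable_hs_inner: "summable (\<lambda>k. hs_inner k (series_of a) (series_of b))"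
  by (rule summable_comparison_test'[OF summable_mult[OF summable_series_of[of b], of "norm a"], of 0])
    (simp add: abs_hs_inner_le_norm)

lemma abs_inner_E_le: "\<bar>inner_E a b\<bar> \<le> norm a * norm b"
proof -
  have s: "summable (\<lambda>k. norm a * hs_norm k (series_of b))"
    by (intro summable_mult summable_series_of)
  have "summable (\<lambda>k. \<bar>hs_inner k (series_of a) (series_of b)\<bar>)"
    by (rule summable_comparison_test'[OF s, of 0]) (simp add: abs_hs_inner_le_norm)
  then have "\<bar>inner_E a b\<bar> \<le> (\<Sum>k. \<bar>hs_inner k (series_of a) (series_of b)\<bar>)"
    unfolding inner_E_def by (rule summable_rabs)
  also have "\<dots> \<le> (\<Sum>k. norm a * hs_norm k (series_of b))"
    by (intro suminf_le abs_hs_inner_le_norm s) fact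
  also have "\<dots> = norm a * norm b"
    by (simp add: norm_tensor_l1.rep_eq suminf_mult summable_series_of)
  finally show ?thesis .
qed

lemma inner_E_commute: "inner_E a b = inner_E b a"
  by (simp add: inner_E_def hs_inner_def mult.commute)

lemma inner_E_add_left: "inner_E (a + b) c = inner_E a c + inner_E b c"
  unfolding inner_E_def by (subst suminf_add[OF summable_hs_inner summable_hs_inner])
    (simp add: hs_inner_def plus_tensor_l1.rep_eq plus_tensor_series.rep_eq distrib_right sum.distrib)

lemma inner_E_scaleR_left: "inner_E (r *\<^sub>R a) c = r * inner_E a c"
  unfolding inner_E_def by (subst suminf_mult[OF summable_hs_inner, symmetric])
    (simp add: hs_inner_def scaleR_tensor_l1.rep_eq scaleR_tensor_series.rep_eq sum_distrib_left
      mult.assoc)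

text \<open>Pairing with a fixed element thereby becomes a bounded linear map, so it commutes with
  derivatives. The rules for the second slot follow from those for the first by symmetry.\<close>

lemma bounded_bilinear_inner_E: "bounded_bilinear inner_E"
proof
  fix a a' b b' :: "'a tensor_l1" and r :: real
  show "inner_E (a + a') b = inner_E a b + inner_E a' b"
    by (rule inner_E_add_left)
  show "inner_E a (b + b') = inner_E a b + inner_E a b'"
    using inner_E_add_left by (simp add: inner_E_commute[of a])
  show "inner_E (r *\<^sub>R a) b = r *\<^sub>R inner_E a b"
    by (simp add: inner_E_scaleR_left)
  show "inner_E a (r *\<^sub>R b) = r *\<^sub>R inner_E a b"
    using inner_E_scaleR_left by (simp add: inner_E_commute[of a])
  show "\<exists>K. \<forall>a b :: 'a tensor_l1. norm (inner_E a b) \<le> norm a * norm b * K"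
    using abs_inner_E_le by (intro exI[of _ 1]) auto
qed

interpretation inner_E: bounded_bilinear inner_E
  by (rule bounded_bilinear_inner_E)

section \<open>Right multiplication by a vector under the pairing\<close>

lemma tcoeff_times_tvec_Nil: "tcoeff (a * tvec v) [] = 0"
  by (simp add: times_tensor_series.rep_eq tvec.rep_eq)

text \<open>\<open>tvec v\<close> is concentrated in degree 1, so of all ways to cut
  \<open>w @ [u]\<close> in two only the cut just before the last letter contributes.\<close>

lemma tcoeff_times_tvec_snoc: "tcoeff (a * tvec v) (w @ [u]) = tcoeff a w * (v \<bullet> u)"
proof -
  have "tcoeff (a * tvec v) (w @ [u]) =
      (\<Sum>k\<le>Suc (length w). if k = length w then tcoeff a w * (v \<bullet> u) else 0)"
    unfolding times_tensor_series.rep_eq tvec.rep_eq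
  proof (rule sum.cong)
    fix k assume "k \<in> {..Suc (length w)}"
    then consider "k = length w" | "k = Suc (length w)" | "k < length w"
      by fastforce
    then show "tcoeff a (take k (w @ [u])) * (case drop k (w @ [u]) of [] \<Rightarrow> 0 | [u] \<Rightarrow> v \<bullet> u | u # _ # _ \<Rightarrow> 0)
        = (if k = length w then tcoeff a w * (v \<bullet> u) else 0)"
    proof cases
      \<comment> \<open>A cut inside \<open>w\<close> leaves at least two letters, \<open>x\<close>
        and the final \<open>u\<close>, and there \<open>tvec v\<close> vanishes.\<close>
      case 3
      then obtain x xs where "drop k w = x # xs"
        by (metis drop_eq_Nil list.exhaust not_le)
      with 3 show ?thesis by (cases xs) auto
    qed auto
  qed simp
  then show ?thesis by simp
qed

lemma hs_inner_times_tvec_0: "hs_inner 0 (a * tvec v) (b * tvec w) = 0"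
  by (auto simp: hs_inner_def words_def tcoeff_times_tvec_Nil intro!: sum.neutral)

text \<open>A word of length \<open>Suc k\<close> is a word of length \<open>k\<close> followed by
  one letter of \<open>Basis\<close>. The sum factorises accordingly, and the sum over the last
  letter is Parseval's identity for \<open>v \<bullet> w\<close>. The coordinates are those of
  \<open>Basis\<close>; the family \<open>e\<close> of the theorem enters only through its inner
  products.\<close>

lemma hs_inner_times_tvec_Suc:
  "hs_inner (Suc k) (a * tvec v) (b * tvec w) = (v \<bullet> w) * hs_inner k a b"
proof -
  have "hs_inner (Suc k) (a * tvec v) (b * tvec w) =
      (\<Sum>(x, u)\<in>words k \<times> Basis. (tcoeff a x * tcoeff b x) * ((v \<bullet> u) * (w \<bullet> u)))"
    unfolding hs_inner_def
  proof (intro sum.reindex_bij_witness[of _ "\<lambda>(x, u). x @ [u]" "\<lambda>x. (butlast x, last x)"])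
    fix x :: "'a list" assume "x \<in> words (Suc k)"
    then obtain y u where x: "x = y @ [u]" "set y \<subseteq> Basis" "u \<in> Basis" "length y = k"
      by (cases x rule: rev_cases) (auto simp: words_def)
    show "(\<lambda>(x, u). x @ [u]) (butlast x, last x) = x"
      and "(butlast x, last x) \<in> words k \<times> Basis"
      and "(case (butlast x, last x) of (x, u) \<Rightarrow> (tcoeff a x * tcoeff b x) * ((v \<bullet> u) * (w \<bullet> u)))
        = tcoeff (a * tvec v) x * tcoeff (b * tvec w) x"
      using x by (simp_all add: words_def tcoeff_times_tvec_snoc)
  qed (auto simp: words_def)
  also have "\<dots> = hs_inner k a b * (v \<bullet> w)"
    unfolding hs_inner_def euclidean_inner[of v w] by (simp add: sum_product sum.cartesian_product)
  finally show ?thesis by simp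
qed

lemma inner_E_times_vec_E: "inner_E (a * vec_E v) (b * vec_E w) = (v \<bullet> w) * inner_E a b"
proof -
  let ?h = "\<lambda>k. hs_inner k (series_of (a * vec_E v)) (series_of (b * vec_E w))"
  \<comment> \<open>Both products vanish in degree 0, so the series may start in degree 1; each of
    its terms is then \<open>v \<bullet> w\<close> times a term of \<open>inner_E a b\<close> one
    degree lower.\<close>
  have "inner_E (a * vec_E v) (b * vec_E w) = (\<Sum>k. ?h (Suc k))"
    unfolding inner_E_def using suminf_split_head[OF summable_hs_inner, of "a * vec_E v" "b * vec_E w"]
    by (simp add: times_tensor_l1.rep_eq vec_E.rep_eq hs_inner_times_tvec_0)
  also have "\<dots> = (v \<bullet> w) * inner_E a b"
    by (simp add: times_tensor_l1.rep_eq vec_E.rep_eq hs_inner_times_tvec_Suc inner_E_def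
        suminf_mult summable_hs_inner)
  finally show ?thesis .
qed

section \<open>Pairings with elements of degrees one and two\<close>

text \<open>The common shape of the two log-signatures, expanded in the vectors
  \<open>e i\<close>.\<close>

definition quadratic_E ::
    "nat \<Rightarrow> (nat \<Rightarrow> 'v::euclidean_space) \<Rightarrow> (nat \<Rightarrow> real) \<Rightarrow> (nat \<Rightarrow> nat \<Rightarrow> real) \<Rightarrow> 'v tensor_l1" where
  "quadratic_E d e c1 c2 = (\<Sum>i=1..d. c1 i *\<^sub>R vec_E (e i)) +
     (\<Sum>i=1..d. \<Sum>j=1..d. c2 i j *\<^sub>R (vec_E (e i) * vec_E (e j)))"

text \<open>The products associate to the left, so that \<open>vec_E (e j)\<close> stands as the
  last right factor, ready to be cancelled by \<open>inner_E_times_vec_E\<close>.\<close>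

lemma inner_E_quadratic_right:
  "inner_E a (b * quadratic_E d e c1 c2) = (\<Sum>i=1..d. c1 i * inner_E a (b * vec_E (e i))) +
     (\<Sum>i=1..d. \<Sum>j=1..d. c2 i j * inner_E a (b * vec_E (e i) * vec_E (e j)))"
  by (simp add: quadratic_E_def distrib_left sum_distrib_left inner_E.add_right inner_E.sum_right
      inner_E.scaleR_right mult.assoc)

lemma inner_E_quadratic_left:
  "inner_E (a * quadratic_E d e c1 c2) b = (\<Sum>i=1..d. c1 i * inner_E (a * vec_E (e i)) b) +
     (\<Sum>i=1..d. \<Sum>j=1..d. c2 i j * inner_E (a * vec_E (e i) * vec_E (e j)) b)"
  by (simp add: inner_E_commute[of _ b] inner_E_quadratic_right)

context
  fixes d :: nat and e :: "nat \<Rightarrow> 'v::euclidean_space"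
  assumes orthonormal: "\<forall>i\<in>{1..d}. \<forall>j\<in>{1..d}. e i \<bullet> e j = (if i = j then 1 else 0)"
begin

text \<open>The summand has the form that \<open>inner_E_times_vec_E\<close> leaves behind; the
  inner products are Kronecker deltas.\<close>

lemma sum_times_orthonormal:
  assumes "j \<in> {1..d}"
  shows "(\<Sum>i=1..d. c i * ((e j \<bullet> e i) * r)) = c j * r"
proof -
  have "(\<Sum>i=1..d. c i * ((e j \<bullet> e i) * r)) = (\<Sum>i=1..d. if i = j then c j * r else 0)"
    using assms orthonormal by (intro sum.cong) auto
  then show ?thesis using assms by simp
qed

text \<open>The factor \<open>e j\<close> on the left cancels against the last factor of each term
  on the right. In degree 1 this selects the index \<open>j\<close>; in degree 2 it selects the
  second index \<open>j\<close> and leaves \<open>e i\<close> attached to \<open>b\<close>. This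
  yields the equation for \<phi>, and its mirror image the one for \<psi>.\<close>

lemma inner_E_times_vec_E_quadratic:
  assumes "j \<in> {1..d}"
  shows "inner_E (a * vec_E (e j)) (b * quadratic_E d e c1 c2) =
    c1 j * inner_E a b + (\<Sum>i=1..d. c2 i j * inner_E a (b * vec_E (e i)))"
  unfolding inner_E_quadratic_right inner_E_times_vec_E
  by (simp only: sum_times_orthonormal[OF assms])

lemma inner_E_quadratic_times_vec_E:
  assumes "j \<in> {1..d}"
  shows "inner_E (a * quadratic_E d e c1 c2) (b * vec_E (e j)) =
    c1 j * inner_E a b + (\<Sum>i=1..d. c2 i j * inner_E (a * vec_E (e i)) b)"
  using inner_E_times_vec_E_quadratic[OF assms, of b a] by (simp add: inner_E_commute)

text \<open>Only the left factor is expanded first, so each term ends in a vector and the previous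
  cancellation applies. Degree 1 against degree 1 and degree 2 against degree 2 give \<gamma>,
  degree 2 against degree 1 gives \<alpha>, and degree 1 against degree 2 gives \<beta>.\<close>

lemma inner_E_quadratic_quadratic:
  "inner_E (a * quadratic_E d e x1 x2) (b * quadratic_E d e y1 y2) =
    ((\<Sum>i=1..d. x1 i * y1 i) + (\<Sum>i=1..d. \<Sum>j=1..d. x2 i j * y2 i j)) * inner_E a b +
    (\<Sum>j=1..d. (\<Sum>i=1..d. x2 j i * y1 i) * inner_E (a * vec_E (e j)) b) +
    (\<Sum>j=1..d. (\<Sum>i=1..d. x1 i * y2 j i) * inner_E a (b * vec_E (e j)))"
proof -
  let ?f = "inner_E a b" and ?\<phi> = "\<lambda>j. inner_E (a * vec_E (e j)) b"
    and ?\<psi> = "\<lambda>j. inner_E a (b * vec_E (e j))"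
  have 1: "x1 i * inner_E (a * vec_E (e i)) (b * quadratic_E d e y1 y2) =
      x1 i * y1 i * ?f + (\<Sum>j=1..d. x1 i * y2 j i * ?\<psi> j)" if "i \<in> {1..d}" for i
    by (simp add: inner_E_times_vec_E_quadratic[OF that] distrib_left sum_distrib_left mult.assoc)
  \<comment> \<open>Two cancellations: \<open>e j\<close> against the last factor on the right, then
    \<open>e i\<close> against the factor that the degree-2 terms keep on \<open>b\<close>.\<close>
  have 2: "x2 i j * inner_E (a * vec_E (e i) * vec_E (e j)) (b * quadratic_E d e y1 y2) =
      x2 i j * y1 j * ?\<phi> i + x2 i j * y2 i j * ?f" if "i \<in> {1..d}" "j \<in> {1..d}" for i j
    unfolding inner_E_times_vec_E_quadratic[OF that(2)] inner_E_times_vec_E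
      sum_times_orthonormal[OF that(1)]
    by (simp add: distrib_left)
  have "inner_E (a * quadratic_E d e x1 x2) (b * quadratic_E d e y1 y2) =
      (\<Sum>i=1..d. x1 i * y1 i * ?f + (\<Sum>j=1..d. x1 i * y2 j i * ?\<psi> j)) +
      (\<Sum>i=1..d. \<Sum>j=1..d. x2 i j * y1 j * ?\<phi> i + x2 i j * y2 i j * ?f)"
    unfolding inner_E_quadratic_left by (simp only: 1 2 cong: sum.cong)
  \<comment> \<open>The two sums are interchanged so that the inner one, over \<open>i\<close>, is
    the coefficient \<beta> at \<open>j\<close>.\<close>
  also have "(\<Sum>i=1..d. x1 i * y1 i * ?f + (\<Sum>j=1..d. x1 i * y2 j i * ?\<psi> j)) =
      (\<Sum>i=1..d. x1 i * y1 i) * ?f + (\<Sum>j=1..d. (\<Sum>i=1..d. x1 i * y2 j i) * ?\<psi> j)"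
    unfolding sum.distrib sum_distrib_right
    by (subst (2) sum.swap) simp
  finally show ?thesis
    by (simp add: sum.distrib sum_distrib_right distrib_right)
qed

end

section \<open>Differentiation of the pairing along the log-ODEs\<close>

lemma inner_E_has_real_derivative_right:
  assumes "(Z has_vector_derivative Z') (at v within S)"
  shows "((\<lambda>v. inner_E a (Z v)) has_real_derivative inner_E a Z') (at v within S)"
  unfolding has_real_derivative_iff_has_vector_derivative
  by (rule bounded_linear.has_vector_derivative[OF inner_E.bounded_linear_right assms])

lemma inner_E_has_real_derivative_left:
  assumes "(Z has_vector_derivative Z') (at u within S)"
  shows "((\<lambda>u. inner_E (Z u) b) has_real_derivative inner_E Z' b) (at u within S)"
  using inner_E_has_real_derivative_right[OF assms, of b] by (simp add: inner_E_commute)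

theorem theorem4p1:
  fixes e :: "nat \<Rightarrow> 'v::euclidean_space" and d :: nat
    and p T s s' t t' :: real
    and X Y :: "real \<Rightarrow> real \<Rightarrow> 'v tensor_series"
    and A B :: "'v tensor_l1"
    and x1 y1 :: "nat \<Rightarrow> real" and x2 y2 :: "nat \<Rightarrow> nat \<Rightarrow> real"
    and Zx Zy :: "real \<Rightarrow> 'v tensor_l1"
    and f :: "real \<Rightarrow> real \<Rightarrow> real" and \<phi> \<psi> :: "nat \<Rightarrow> real \<Rightarrow> real \<Rightarrow> real"
    and \<alpha> \<beta> :: "nat \<Rightarrow> real" and \<gamma> :: real
  assumes dim: "d = DIM('v)"
    and orthonormal: "\<forall>i\<in>{1..d}. \<forall>j\<in>{1..d}. e i \<bullet> e j = (if i = j then 1 else 0)"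
    and p: "1 \<le> p" "p < 3"
    and X: "geometric_rough_path p T X" and Y: "geometric_rough_path p T Y"
    and ss': "0 \<le> s" "s \<le> s'" "s' \<le> T" and tt': "0 \<le> t" "t \<le> t'" "t' \<le> T"
    and x: "log_signature 2 p T X s s' =
        (\<Sum>i=1..d. x1 i *\<^sub>R vec_E (e i)) +
        (\<Sum>i=1..d. \<Sum>j=1..d. x2 i j *\<^sub>R (vec_E (e i) * vec_E (e j)))"
    and y: "log_signature 2 p T Y t t' =
        (\<Sum>i=1..d. y1 i *\<^sub>R vec_E (e i)) +
        (\<Sum>i=1..d. \<Sum>j=1..d. y2 i j *\<^sub>R (vec_E (e i) * vec_E (e j)))"
    and Zx: "\<forall>u\<in>{0..1}. (Zx has_vector_derivative Zx u * log_signature 2 p T X s s')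
               (at u within {0..1})" "Zx 0 = A"
    and Zy: "\<forall>v\<in>{0..1}. (Zy has_vector_derivative Zy v * log_signature 2 p T Y t t')
               (at v within {0..1})" "Zy 0 = B"
    and f: "f = (\<lambda>u v. inner_E (Zx u) (Zy v))"
    and \<phi>: "\<phi> = (\<lambda>i u v. inner_E (Zx u * vec_E (e i)) (Zy v))"
    and \<psi>: "\<psi> = (\<lambda>i u v. inner_E (Zx u) (Zy v * vec_E (e i)))"
    and \<alpha>: "\<alpha> = (\<lambda>j. \<Sum>i=1..d. x2 j i * y1 i)"
    and \<beta>: "\<beta> = (\<lambda>j. \<Sum>i=1..d. x1 i * y2 j i)"
    and \<gamma>: "\<gamma> = (\<Sum>i=1..d. x1 i * y1 i) + (\<Sum>i=1..d. \<Sum>j=1..d. x2 i j * y2 i j)"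
  shows "(\<exists>f\<^sub>v. \<forall>u\<in>{0..1}. \<forall>v\<in>{0..1}.
        ((\<lambda>v. f u v) has_real_derivative f\<^sub>v u v) (at v within {0..1}) \<and>
        ((\<lambda>u. f\<^sub>v u v) has_real_derivative
           \<gamma> * f u v + (\<Sum>j=1..d. \<alpha> j * \<phi> j u v) + (\<Sum>j=1..d. \<beta> j * \<psi> j u v))
          (at u within {0..1})) \<and>
    (\<forall>u\<in>{0..1}. \<forall>v\<in>{0..1}. \<forall>j\<in>{1..d}.
        ((\<lambda>v. \<phi> j u v) has_real_derivative
           y1 j * f u v + (\<Sum>i=1..d. y2 i j * \<psi> i u v)) (at v within {0..1}) \<and>
        ((\<lambda>u. \<psi> j u v) has_real_derivative
           x1 j * f u v + (\<Sum>i=1..d. x2 i j * \<phi> i u v)) (at u within {0..1})) \<and>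
    (\<forall>v\<in>{0..1}. f 0 v = inner_E A (Zy v) \<and>
        (\<forall>i\<in>{1..d}. \<phi> i 0 v = inner_E (A * vec_E (e i)) (Zy v) \<and>
                     \<psi> i 0 v = inner_E A (Zy v * vec_E (e i)))) \<and>
    (\<forall>u\<in>{0..1}. f u 0 = inner_E (Zx u) B \<and>
        (\<forall>i\<in>{1..d}. \<phi> i u 0 = inner_E (Zx u * vec_E (e i)) B \<and>
                     \<psi> i u 0 = inner_E (Zx u) (B * vec_E (e i))))"
proof -
  let ?Lx = "quadratic_E d e x1 x2" and ?Ly = "quadratic_E d e y1 y2"
  have dZx: "(Zx has_vector_derivative Zx u * ?Lx) (at u within {0..1})" if "u \<in> {0..1}" for u
    using Zx(1) that by (simp add: x quadratic_E_def)
  have dZy: "(Zy has_vector_derivative Zy v * ?Ly) (at v within {0..1})" if "v \<in> {0..1}" for v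
    using Zy(1) that by (simp add: y quadratic_E_def)
  \<comment> \<open>The derivative in \<open>v\<close> is left as a pairing with
    \<open>Zy v * ?Ly\<close>. This is constant in \<open>u\<close>, so the derivative in
    \<open>u\<close> pairs the two quadratic elements.\<close>
  have "((\<lambda>v. f u v) has_real_derivative inner_E (Zx u) (Zy v * ?Ly)) (at v within {0..1})"
    and "((\<lambda>u. inner_E (Zx u) (Zy v * ?Ly)) has_real_derivative
      \<gamma> * f u v + (\<Sum>j=1..d. \<alpha> j * \<phi> j u v) + (\<Sum>j=1..d. \<beta> j * \<psi> j u v)) (at u within {0..1})"
    if "u \<in> {0..1}" "v \<in> {0..1}" for u v
    using inner_E_has_real_derivative_right[OF dZy[OF that(2)], of "Zx u"]
      inner_E_has_real_derivative_left[OF dZx[OF that(1)], of "Zy v * ?Ly"]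
    by (simp_all add: f \<phi> \<psi> \<alpha> \<beta> \<gamma> inner_E_quadratic_quadratic[OF orthonormal])
  then have "\<exists>f\<^sub>v. \<forall>u\<in>{0..1}. \<forall>v\<in>{0..1}.
      ((\<lambda>v. f u v) has_real_derivative f\<^sub>v u v) (at v within {0..1}) \<and>
      ((\<lambda>u. f\<^sub>v u v) has_real_derivative
        \<gamma> * f u v + (\<Sum>j=1..d. \<alpha> j * \<phi> j u v) + (\<Sum>j=1..d. \<beta> j * \<psi> j u v)) (at u within {0..1})"
    by (intro exI[of _ "\<lambda>u v. inner_E (Zx u) (Zy v * ?Ly)"]) blast
  \<comment> \<open>The slot held fixed carries the right factor \<open>e j\<close>, which cancels
    against the quadratic element brought into the other slot by its ODE.\<close>
  moreover have "((\<lambda>v. \<phi> j u v) has_real_derivative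
        y1 j * f u v + (\<Sum>i=1..d. y2 i j * \<psi> i u v)) (at v within {0..1})"
    and "((\<lambda>u. \<psi> j u v) has_real_derivative
        x1 j * f u v + (\<Sum>i=1..d. x2 i j * \<phi> i u v)) (at u within {0..1})"
    if "u \<in> {0..1}" "v \<in> {0..1}" "j \<in> {1..d}" for u v j
    using inner_E_has_real_derivative_right[OF dZy[OF that(2)], of "Zx u * vec_E (e j)"]
      inner_E_has_real_derivative_left[OF dZx[OF that(1)], of "Zy v * vec_E (e j)"]
    unfolding f \<phi> \<psi> inner_E_times_vec_E_quadratic[OF orthonormal that(3)]
      inner_E_quadratic_times_vec_E[OF orthonormal that(3)]
    by simp_all
  moreover have "\<forall>v\<in>{0..1}. f 0 v = inner_E A (Zy v) \<and>
      (\<forall>i\<in>{1..d}. \<phi> i 0 v = inner_E (A * vec_E (e i)) (Zy v) \<and>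
        \<psi> i 0 v = inner_E A (Zy v * vec_E (e i)))"
    and "\<forall>u\<in>{0..1}. f u 0 = inner_E (Zx u) B \<and>
      (\<forall>i\<in>{1..d}. \<phi> i u 0 = inner_E (Zx u * vec_E (e i)) B \<and>
        \<psi> i u 0 = inner_E (Zx u) (B * vec_E (e i)))"
    by (simp_all add: f \<phi> \<psi> Zx(2) Zy(2))
  ultimately show ?thesis by blast
qed

end
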